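(* Let $\alpha := 2^{-5/2}\, 3^{1/2}\, \pi$ (so that $\alpha<1$). Let $k\ge 1$ be an integer and let $f\in C(T)$. Then for every integer $n\ge 2k$, $$ E_n(f) \le \frac{2(k+1)^2}{\binom{2k}{k}}\ \omega_{2k}\Bigl(f, \frac{2\pi}{n}\,\alpha\,(1+1/k)\Bigr). $$
   Context: $T=[-\pi,\pi)$ is the circle $\mathbb{R}/2\pi\mathbb{Z}$, and $C(T)$ is the space of continuous (complex-valued, $2\pi$-periodic) functions on $T$ with norm $\|f\|:=\max_{x\in T}|f(x)|$. $T_n$ denotes the space of trigonometric polynomials $\sum_{j=-n}^{n}c_je^{ijt}$ of degree at most $n$, and $E_n(f):=\inf_{\tau\in T_n}\|f-\tau\|$ is the best uniform approximation of $f$ by elements of $T_n$. For an integer $m\ge1$ and a real step $h$, the (central) $m$-th difference is $$\Delta_h^m f(x):=\sum_{i=0}^m(-1)^{m-i}\binom{m}{i} f\bigl(x-(m/2)h+ih\bigr),$$ and the $m$-th modulus of smoothness is $\omega_m(f,\delta):=\sup_{x\in T,\ |h|<\delta}|\Delta_h^m f(x)|$ for $\delta>0$. *)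

theory Defs
  imports "HOL-Analysis.Analysis"
begin

definition circle :: "real set" where
  "circle = {-pi..<pi}"

text \<open>The space $C(T)$: functions on $T = \mathbb{R}/2\pi\mathbb{Z}$ are represented by
  $2\pi$-periodic functions on the line.\<close>

definition CT :: "(real \<Rightarrow> complex) set" where
  "CT = {f. continuous_on UNIV f \<and> (\<forall>x. f (x + 2 * pi) = f x)}"

text \<open>For \<^term>\<open>f \<in> CT\<close> the supremum is a maximum, see \<open>normT_attained\<close> below.\<close>

definition normT :: "(real \<Rightarrow> complex) \<Rightarrow> real" where
  "normT f = (SUP x\<in>circle. norm (f x))"

definition trig_polys :: "nat \<Rightarrow> (real \<Rightarrow> complex) set" where
  "trig_polys n =
     {\<tau>. \<exists>c :: int \<Rightarrow> complex.
        \<tau> = (\<lambda>t. \<Sum>j = - int n..int n. c j * exp (\<i> * of_int j * of_real t))}"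

definition best_approx :: "nat \<Rightarrow> (real \<Rightarrow> complex) \<Rightarrow> real" where
  "best_approx n f = (INF \<tau>\<in>trig_polys n. normT (\<lambda>x. f x - \<tau> x))"

definition central_diff :: "nat \<Rightarrow> real \<Rightarrow> (real \<Rightarrow> complex) \<Rightarrow> real \<Rightarrow> complex" where
  "central_diff m h f x =
     (\<Sum>i = 0..m. (-1) ^ (m - i) * of_nat (m choose i) * f (x - real m / 2 * h + real i * h))"

text \<open>For \<^term>\<open>f \<in> CT\<close> and \<^term>\<open>\<delta> > 0\<close> the supremum is over a non-empty set that is
  bounded above, see \<open>bdd_above_central_diff\<close> below.\<close>

definition modulus_smoothness :: "nat \<Rightarrow> (real \<Rightarrow> complex) \<Rightarrow> real \<Rightarrow> real" where
  "modulus_smoothness m f \<delta> =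
     (SUP (x, h) \<in> {(x, h). x \<in> circle \<and> \<bar>h\<bar> < \<delta>}. norm (central_diff m h f x))"

definition alpha :: real where
  "alpha = 2 powr (-5/2) * 3 powr (1/2) * pi"

lemma CT_attains_sup:
  assumes "f \<in> CT"
  shows "\<exists>x\<in>circle. \<forall>y. norm (f y) \<le> norm (f x)"
proof -
  from assms have cont: "continuous_on UNIV f" and per: "\<And>x. f (x + 2 * pi) = f x"
    by (auto simp: CT_def)
  interpret periodic_fun_simple f "2 * pi"
    by unfold_locales (fact per)
  have rep: "\<exists>z\<in>circle. f z = f y" for y
  proof (rule bexI)
    let ?n = "\<lfloor>(y + pi) / (2 * pi)\<rfloor>"
    show "f (y - of_int ?n * (2 * pi)) = f y"
      by (rule minus_of_int)
    have "of_int ?n * (2 * pi) \<le> y + pi" "y + pi < (of_int ?n + 1) * (2 * pi)"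
      by (rule floor_divide_lower, simp) (rule floor_divide_upper, simp)
    then show "y - of_int ?n * (2 * pi) \<in> circle"
      by (simp add: circle_def algebra_simps)
  qed
  have "continuous_on {-pi..pi} (\<lambda>x. norm (f x))"
    by (intro continuous_on_norm continuous_on_subset[OF cont]) auto
  then obtain x where x: "\<forall>y\<in>{-pi..pi}. norm (f y) \<le> norm (f x)"
    using continuous_attains_sup[of "{-pi..pi}" "\<lambda>x. norm (f x)"] by auto
  obtain z where z: "z \<in> circle" "f z = f x"
    using rep by blast
  have "norm (f y) \<le> norm (f z)" for y
  proof -
    obtain w where w: "w \<in> circle" "f w = f y"
      using rep by blast
    have "w \<in> {-pi..pi}"
      using w(1) by (auto simp: circle_def)
    then have "norm (f w) \<le> norm (f x)"
      using x by blast
    then show ?thesis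
      using w z by simp
  qed
  with z show ?thesis by blast
qed

lemma normT_attained:
  assumes "f \<in> CT"
  shows "\<exists>x\<in>circle. normT f = norm (f x) \<and> (\<forall>y. norm (f y) \<le> norm (f x))"
proof -
  obtain x where x: "x \<in> circle" "\<And>y. norm (f y) \<le> norm (f x)"
    using CT_attains_sup[OF assms] by blast
  have "normT f = norm (f x)"
    unfolding normT_def by (rule cSup_eq_maximum) (use x in auto)
  with x show ?thesis by blast
qed

lemma bdd_above_central_diff:
  assumes "f \<in> CT"
  shows "bdd_above ((\<lambda>(x, h). norm (central_diff m h f x)) ` A)"
proof -
  obtain M where M: "\<And>y. norm (f y) \<le> M"
    using CT_attains_sup[OF assms] by blast
  have "norm (central_diff m h f x) \<le> (\<Sum>i = 0..m. real (m choose i) * M)" for x h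
    unfolding central_diff_def
    by (intro sum_norm_le) (simp add: norm_mult norm_power mult_left_mono M)
  then show ?thesis
    by (intro bdd_aboveI) auto
qed

lemma alpha_less_1: "alpha < 1"
proof -
  have "pi < 3.25"
  proof (rule ccontr)
    assume "\<not> pi < 3.25"
    then have le: "(13/24 :: real) \<le> pi / 6" by simp
    have "\<bar>sin (13/24 :: real) - (\<Sum>m<4. sin_coeff m * (13/24) ^ m)\<bar>
            \<le> inverse (fact 4) * \<bar>13/24\<bar> ^ 4"
      by (rule Maclaurin_sin_bound)
    moreover have "(\<Sum>m<4. sin_coeff m * (13/24) ^ m) = 13/24 - (13/24 :: real) ^ 3 / 6"
    proof -
      have "{..<4} = {0, 1, 2, 3 :: nat}" by auto
      then show ?thesis by (simp add: sin_coeff_def fact_numeral)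
    qed
    moreover have "(13/24 - (13/24) ^ 3 / 6) - inverse (fact 4) * \<bar>13/24\<bar> ^ 4 > (1/2 :: real)"
      by (simp add: fact_numeral power_divide)
    ultimately have "sin (13/24 :: real) > 1/2"
      by linarith
    moreover have "sin (13/24 :: real) \<le> sin (pi / 6)"
      using le pi_gt_zero by (intro sin_monotone_2pi_le) auto
    ultimately show False by (simp add: sin_30)
  qed
  then have "pi ^ 2 < 3.25 ^ 2"
    by (intro power_strict_mono) auto
  have "(2 powr (-5/2)) ^ 2 = (1/32 :: real)"
    by (subst powr_power) (simp_all add: powr_minus)
  moreover have "(3 powr (1/2)) ^ 2 = (3 :: real)"
    by (simp add: powr_power)
  ultimately have "alpha ^ 2 = 3 / 32 * pi ^ 2"
    unfolding alpha_def power_mult_distrib by simp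
  with \<open>pi ^ 2 < 3.25 ^ 2\<close> have "alpha ^ 2 < 1 ^ 2"
    by (simp add: power_divide)
  then show ?thesis
    by (rule power_less_imp_less_base) simp
qed

end

theory Submission
  imports Defs
begin

text \<open>
  By density it suffices to treat a trigonometric polynomial $p$. Averaging
  $\pm\Delta_t^{2k} p / {2k \choose k}$ over $0 \le t \le h$ with the weight $2(h-t)/h^2$ gives
  $p - Up$, where $U$ is a Fourier multiplier; hence
  $\|p - Up\| \le \omega_{2k}(p,h) / {2k \choose k}$. The weight is chosen so that $j^2$ times the
  multiplier of $U$ is the multiplier of a combination $V$ of second differences, which has norm
  at most $4 h^{-2} (\pi^2/6 + 1)$. Extending $j \mapsto 1/j^2$ from $|j| > n$ to a convex
  sequence by the tangent line at $N = n + 1$ gives a multiplier $R$ which is a positive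
  combination of Fejer means and so has norm $3/N^2$, its value at $0$. As $RV$ and $U$ agree on
  frequencies above $n$, for all $\sigma \in T_n$ the function $Up$ is within
  $q \, \|p - \sigma\|$ of $T_n$, where $q = 12 (\pi^2/6 + 1) / (N h)^2$. Hence
  $(1 - q) E_n(p) \le \omega_{2k}(p,h) / {2k \choose k}$, and for the given $h$ one has
  $q \le (k/(k+1))^2$ because $\pi^2 \ge 9$.
\<close>

subsection \<open>Trigonometric polynomials and best approximation\<close>

definition trig_poly :: "nat \<Rightarrow> (int \<Rightarrow> complex) \<Rightarrow> real \<Rightarrow> complex" where
  "trig_poly M c x = (\<Sum>j = - int M..int M. c j * cis (of_int j * x))"

lemma trig_polys_eq: "trig_polys M = range (trig_poly M)"
proof -
  have "exp (\<i> * of_int j * of_real t) = cis (of_int j * t)" for j :: int and t :: real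
    by (simp add: cis_conv_exp mult.assoc)
  then show ?thesis
    unfolding trig_polys_def trig_poly_def [abs_def] by auto
qed

lemma trig_poly_pad:
  assumes "M \<le> M'"
  shows "trig_poly M c = trig_poly M' (\<lambda>j. if \<bar>j\<bar> \<le> int M then c j else 0)"
  unfolding trig_poly_def
  by (intro ext sum.mono_neutral_cong_left) (use assms in auto)

lemma trig_polys_mono: "M \<le> M' \<Longrightarrow> trig_polys M \<subseteq> trig_polys M'"
  unfolding trig_polys_eq using trig_poly_pad by blast

lemma trig_poly_add: "trig_poly M c x + trig_poly M d x = trig_poly M (\<lambda>j. c j + d j) x"
  by (simp add: trig_poly_def sum.distrib ring_distribs)

lemma trig_poly_diff: "trig_poly M c x - trig_poly M d x = trig_poly M (\<lambda>j. c j - d j) x"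
  by (simp add: trig_poly_def sum_subtractf ring_distribs)

lemma trig_poly_scale: "b * trig_poly M c x = trig_poly M (\<lambda>j. b * c j) x"
  by (simp add: trig_poly_def sum_distrib_left mult.assoc)

lemma trig_poly_sum:
  "(\<Sum>i\<in>I. trig_poly M (c i) x) = trig_poly M (\<lambda>j. \<Sum>i\<in>I. c i j) x"
  unfolding trig_poly_def by (subst sum.swap) (simp add: sum_distrib_right)

lemma trig_poly_shift: "trig_poly M c (x + y) = trig_poly M (\<lambda>j. cis (of_int j * y) * c j) x"
  by (simp add: trig_poly_def ring_distribs cis_mult [symmetric] mult_ac)

lemma trig_poly_truncate:
  assumes "n \<le> M" "\<And>j. \<bar>j\<bar> > int n \<Longrightarrow> c j = 0"
  shows "trig_poly M c \<in> trig_polys n"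
proof -
  have "(\<lambda>j. if \<bar>j\<bar> \<le> int n then c j else 0) = c"
    using assms(2) by (auto simp: fun_eq_iff)
  then show ?thesis
    using trig_poly_pad[OF assms(1), of c] by (metis rangeI trig_polys_eq)
qed

lemma trig_poly_sym_sum:
  "trig_poly M c (x + y) + trig_poly M c (x - y)
     = trig_poly M (\<lambda>j. of_real (2 * cos (of_int j * y)) * c j) x"
proof -
  have "complex_of_real (2 * cos t) = cis t + cis (- t)" for t :: real
    by (simp add: complex_eq_iff)
  then show ?thesis
    by (simp only: trig_poly_shift trig_poly_add diff_conv_add_uminus[of x y])
       (simp add: distrib_right)
qed

lemma trig_poly_in_CT: "trig_poly M c \<in> CT"
proof -
  have "cis (of_int j * (x + 2 * pi)) = cis (of_int j * x)" for j :: int and x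
    using cis_multiple_2pi[of "of_int j"]
    by (simp add: ring_distribs cis_mult [symmetric] mult_ac)
  then show ?thesis
    unfolding CT_def trig_poly_def by (auto intro!: continuous_intros)
qed

lemma CT_diff: "f \<in> CT \<Longrightarrow> g \<in> CT \<Longrightarrow> (\<lambda>x. f x - g x) \<in> CT"
  unfolding CT_def by (auto intro!: continuous_intros)

lemma norm_le_normT: "f \<in> CT \<Longrightarrow> norm (f x) \<le> normT f"
  using normT_attained by metis

lemma normT_le:
  assumes "\<And>x. x \<in> circle \<Longrightarrow> norm (f x) \<le> B"
  shows "normT f \<le> B"
  unfolding normT_def by (rule cSUP_least) (auto simp: circle_def assms)

lemma normT_nonneg: "f \<in> CT \<Longrightarrow> 0 \<le> normT f"
  using norm_le_normT norm_ge_zero order_trans by blast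

lemma best_approx_le:
  assumes "f \<in> CT" "\<tau> \<in> trig_polys n"
  shows "best_approx n f \<le> normT (\<lambda>x. f x - \<tau> x)"
  unfolding best_approx_def
proof (rule cINF_lower[OF _ assms(2)])
  show "bdd_below ((\<lambda>\<tau>. normT (\<lambda>x. f x - \<tau> x)) ` trig_polys n)"
  proof (rule bdd_belowI2)
    fix \<tau> assume "\<tau> \<in> trig_polys n"
    then show "0 \<le> normT (\<lambda>x. f x - \<tau> x)"
      using assms(1) trig_poly_in_CT by (auto simp: trig_polys_eq intro!: normT_nonneg CT_diff)
  qed
qed

lemma best_approx_greatest:
  assumes "\<And>\<tau>. \<tau> \<in> trig_polys n \<Longrightarrow> B \<le> normT (\<lambda>x. f x - \<tau> x)"
  shows "B \<le> best_approx n f"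
  unfolding best_approx_def using assms by (intro cINF_greatest) (auto simp: trig_polys_eq)

lemma best_approx_nonneg: "f \<in> CT \<Longrightarrow> 0 \<le> best_approx n f"
  by (rule best_approx_greatest)
     (auto simp: trig_polys_eq intro!: normT_nonneg CT_diff trig_poly_in_CT)

lemma best_approx_perturb:
  assumes "f \<in> CT" "g \<in> CT" "\<And>x. norm (f x - g x) \<le> e"
  shows "best_approx n f \<le> best_approx n g + e"
proof -
  have "best_approx n f - e \<le> normT (\<lambda>x. g x - \<tau> x)" if \<tau>: "\<tau> \<in> trig_polys n" for \<tau>
  proof -
    have "\<tau> \<in> CT" using \<tau> trig_poly_in_CT by (auto simp: trig_polys_eq)
    have "norm (f x - \<tau> x) \<le> e + normT (\<lambda>x. g x - \<tau> x)" for x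
      using norm_triangle_ineq[of "f x - g x" "g x - \<tau> x"] assms(3)[of x]
        norm_le_normT[OF CT_diff[OF assms(2) \<open>\<tau> \<in> CT\<close>], of x]
      by simp
    then have "normT (\<lambda>x. f x - \<tau> x) \<le> e + normT (\<lambda>x. g x - \<tau> x)"
      by (rule normT_le)
    then show ?thesis
      using best_approx_le[OF assms(1) \<tau>] by simp
  qed
  then show ?thesis
    using best_approx_greatest[of n "best_approx n f - e" g] by auto
qed

subsection \<open>Fejer means and convex multipliers\<close>

text \<open>The terms are the powers $z^m$ of a $P$-th root of unity $z$. The bound on $d$ makes $z
  = 1$ possible only for $d = 0$; otherwise the geometric sum vanishes because $z^P = 1$.\<close>

lemma sum_cis_grid:
  assumes "\<bar>d\<bar> < int P"
  shows "(\<Sum>m<P. cis (of_int d * (2 * pi * real m / real P))) = (if d = 0 then of_nat P else 0)"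
proof (cases "d = 0")
  case False
  define z where "z = cis (2 * pi * (of_int d / real P))"
  have P: "P > 0" using assms by auto
  have "z \<noteq> 1"
  proof
    assume "z = 1"
    then have "cos (2 * pi * (of_int d / real P)) = 1"
      by (simp add: z_def complex_eq_iff)
    then obtain i :: int where "2 * pi * (of_int d / real P) = of_int i * 2 * pi"
      using cos_one_2pi_int by auto
    then have "real_of_int d = of_int i * real P"
      using P by (simp add: field_simps)
    then have "d = i * int P"
      by (metis of_int_eq_iff of_int_mult of_int_of_nat_eq)
    then show False
      using assms False by (auto simp: abs_mult mult_less_cancel_right2)
  qed
  have "z ^ P = cis (2 * pi * of_int d)"
    using P by (simp add: z_def Complex.DeMoivre)
  then have "z ^ P = 1" by simp
  have "cis (of_int d * (2 * pi * real m / real P)) = z ^ m" for m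
    unfolding z_def Complex.DeMoivre by (simp add: field_simps)
  then show ?thesis
    using False \<open>z \<noteq> 1\<close> \<open>z ^ P = 1\<close> by (simp add: sum_gp_strict)
qed simp

text \<open>This is $r$ times the usual Fejer kernel.\<close>

definition fejer_kernel :: "nat \<Rightarrow> real \<Rightarrow> real" where
  "fejer_kernel r t = (norm (\<Sum>s<r. cis (of_nat s * t)))\<^sup>2"

lemma fejer_kernel_nonneg: "fejer_kernel r t \<ge> 0"
  by (simp add: fejer_kernel_def)

lemma fejer_kernel_expand:
  "complex_of_real (fejer_kernel r t) = (\<Sum>s<r. \<Sum>s'<r. cis (of_int (int s - int s') * t))"
  by (simp add: fejer_kernel_def complex_norm_square sum_product cis_cnj cis_mult
      ring_distribs del: of_real_power)

text \<open>These numbers are the Fourier coefficients of \<open>fejer_kernel\<close>. Given $s$,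
  the only candidate for $s'$ is $s + j$, and the $s$ for which it lies below $r$ fill an
  interval.\<close>

lemma sum_diagonal_count:
  "(\<Sum>s<r. \<Sum>s'<r. if int s - int s' + j = 0 then (1::complex) else 0)
     = of_real (max 0 (real r - of_int \<bar>j\<bar>))"
proof -
  have "(\<Sum>s'<r. if int s - int s' + j = 0 then (1::complex) else 0)
      = (if s \<in> {nat (- j)..<nat (int r - j)} then 1 else 0)" for s
  proof -
    have "(\<Sum>s'<r. if int s - int s' + j = 0 then (1::complex) else 0)
        = (\<Sum>s'<r. if s' = nat (int s + j) then (if int s + j \<ge> 0 then 1 else 0) else 0)"
      by (intro sum.cong) auto
    also have "\<dots> = (if s \<in> {nat (- j)..<nat (int r - j)} then 1 else 0)"
      by (subst sum.delta) auto
    finally show ?thesis .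
  qed
  then have "(\<Sum>s<r. \<Sum>s'<r. if int s - int s' + j = 0 then (1::complex) else 0)
      = of_nat (card ({..<r} \<inter> {nat (- j)..<nat (int r - j)}))"
    by (simp add: sum.If_cases Int_def del: atLeastLessThan_iff)
  also have "{..<r} \<inter> {nat (- j)..<nat (int r - j)} = {nat (- j)..<min r (nat (int r - j))}"
    by auto
  also have "of_nat (card \<dots>) = complex_of_real (max 0 (real r - of_int \<bar>j\<bar>))"
    by (cases "j \<ge> 0"; cases "\<bar>j\<bar> \<le> int r") (auto simp: min_def max_def of_nat_diff)
  finally show ?thesis .
qed

text \<open>The grid has more points than the frequencies that occur, so averaging over it acts like
  integration over the circle.\<close>

lemma fejer_mean_discrete:
  assumes "M + r \<le> P"
  shows "(\<Sum>m<P. of_real (fejer_kernel r (2 * pi * real m / real P))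
             * trig_poly M c (x + 2 * pi * real m / real P))
     = of_nat P * trig_poly M (\<lambda>j. of_real (max 0 (real r - of_int \<bar>j\<bar>)) * c j) x"
proof -
  define g where "g m = 2 * pi * real m / real P" for m
  \<comment> \<open>The frequency has absolute value at most $(r - 1) + M < P$, so no aliasing
    occurs on the grid.\<close>
  have grid: "(\<Sum>m<P. cis (of_int (int s - int s' + j) * g m))
      = of_nat P * (if int s - int s' + j = 0 then 1 else 0)"
    if "s < r" "s' < r" "j \<in> {- int M..int M}" for s s' j
    unfolding g_def using that assms by (subst sum_cis_grid) auto
  have "(\<Sum>m<P. of_real (fejer_kernel r (g m)) * trig_poly M c (x + g m))
      = (\<Sum>m<P. \<Sum>j=-int M..int M. \<Sum>s<r. \<Sum>s'<r.
          c j * cis (of_int j * x) * cis (of_int (int s - int s' + j) * g m))"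
    unfolding fejer_kernel_expand trig_poly_def sum_distrib_left sum_distrib_right
    by (intro sum.cong refl) (simp add: cis_mult algebra_simps)
  also have "\<dots> = (\<Sum>j=-int M..int M. \<Sum>s<r. \<Sum>s'<r. \<Sum>m<P.
          c j * cis (of_int j * x) * cis (of_int (int s - int s' + j) * g m))"
    by (subst sum.swap, rule sum.cong[OF refl], subst sum.swap, rule sum.cong[OF refl], rule sum.swap)
  also have "\<dots> = (\<Sum>j=-int M..int M. \<Sum>s<r. \<Sum>s'<r.
          c j * cis (of_int j * x) * (of_nat P * (if int s - int s' + j = 0 then 1 else 0)))"
    by (intro sum.cong refl) (simp only: sum_distrib_left[symmetric] lessThan_iff grid)
  also have "\<dots> = (\<Sum>j=-int M..int M. c j * cis (of_int j * x) * (of_nat P *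
          of_real (max 0 (real r - of_int \<bar>j\<bar>))))"
    unfolding sum_diagonal_count[symmetric] sum_distrib_left ..
  finally show ?thesis
    by (simp add: g_def trig_poly_def sum_distrib_left mult_ac)
qed

text \<open>Averaging against a nonnegative kernel has norm at most the mean of the kernel. That
  mean is $r$, as the discrete formula for the constant polynomial 1 of degree 0 shows.\<close>

lemma fejer_mean_bound:
  assumes B: "\<And>x. norm (trig_poly M c x) \<le> B"
  shows "norm (trig_poly M (\<lambda>j. of_real (max 0 (real r - of_int \<bar>j\<bar>)) * c j) x) \<le> real r * B"
proof -
  \<comment> \<open>The successor keeps $P$ positive even if $M = r = 0$, so that it can be
    cancelled at the end.\<close>
  define P where "P = Suc (M + r)"
  define K where "K m = fejer_kernel r (2 * pi * real m / real P)" for m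
  have "complex_of_real (\<Sum>m<P. K m) = of_nat P * of_nat r"
    using fejer_mean_discrete[of 0 r P "\<lambda>_. 1" 0] by (simp add: K_def P_def trig_poly_def)
  then have K: "(\<Sum>m<P. K m) = real P * real r"
    by (metis of_nat_mult of_real_eq_iff of_real_of_nat_eq)
  have "real P * norm (trig_poly M (\<lambda>j. of_real (max 0 (real r - of_int \<bar>j\<bar>)) * c j) x)
      = norm (\<Sum>m<P. of_real (K m) * trig_poly M c (x + 2 * pi * real m / real P))"
    unfolding K_def by (subst fejer_mean_discrete) (simp_all add: P_def norm_mult del: of_nat_Suc)
  also have "\<dots> \<le> (\<Sum>m<P. K m * B)"
    by (intro sum_norm_le)
       (simp add: norm_mult K_def fejer_kernel_nonneg mult_left_mono B)
  also have "\<dots> = real P * (real r * B)"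
    by (simp add: sum_distrib_right[symmetric] K)
  finally show ?thesis
    by (simp add: P_def del: of_nat_Suc)
qed

text \<open>A discrete Taylor formula at the right end \<open>Suc M\<close> with second differences
  in the remainder, that is, summation by parts done twice. The functions
  \<open>max 0 (real r - real j)\<close> in it are the multipliers of the Fejer means.\<close>

lemma convex_sequence_expand:
  fixes a :: "nat \<Rightarrow> real"
  assumes "j \<le> M"
  shows "a j = a (Suc M) + (real (Suc M) - real j) * (a M - a (Suc M))
    + (\<Sum>r=1..M. max 0 (real r - real j) * (a (r - 1) - 2 * a r + a (Suc r)))"
  using assms
proof (induction M rule: dec_induct)
  case base
  have "(\<Sum>r=1..j. max 0 (real r - real j) * (a (r - 1) - 2 * a r + a (Suc r))) = 0"
    by (intro sum.neutral) auto
  then show ?case by simp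
next
  case (step M)
  then show ?case
    by (subst step.IH) (simp add: max_def algebra_simps)
qed

text \<open>Convexity, together with the two conditions at the right end, makes all coefficients of
  the expansion into Fejer multipliers nonnegative. The norms then add up without loss: the sum of
  coefficient times bound is the same expansion evaluated at index 0, which gives exactly
  \<open>a 0\<close>.\<close>

theorem convex_multiplier_bound:
  fixes a :: "nat \<Rightarrow> real"
  assumes nonneg: "a (Suc M) \<ge> 0" and decr: "a (Suc M) \<le> a M"
    and convex: "\<And>r. 1 \<le> r \<Longrightarrow> r \<le> M \<Longrightarrow> 2 * a r \<le> a (r - 1) + a (Suc r)"
    and B: "\<And>x. norm (trig_poly M c x) \<le> B"
  shows "norm (trig_poly M (\<lambda>j. of_real (a (nat \<bar>j\<bar>)) * c j) x) \<le> a 0 * B"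
proof -
  define D where "D r = a (r - 1) - 2 * a r + a (Suc r)" for r
  define F where "F r = trig_poly M (\<lambda>j. of_real (max 0 (real r - of_int \<bar>j\<bar>)) * c j) x" for r
  have F: "norm (F r) \<le> real r * B" for r
    unfolding F_def by (rule fejer_mean_bound[OF B])
  have "trig_poly M (\<lambda>j. of_real (a (nat \<bar>j\<bar>)) * c j) x
      = trig_poly M (\<lambda>j. of_real (a (Suc M)) * c j
          + of_real (a M - a (Suc M)) * (of_real (max 0 (real (Suc M) - of_int \<bar>j\<bar>)) * c j)
          + (\<Sum>r=1..M. of_real (D r) * (of_real (max 0 (real r - of_int \<bar>j\<bar>)) * c j))) x"
    unfolding trig_poly_def
  proof (intro sum.cong refl)
    fix j :: int assume "j \<in> {- int M..int M}"
    then have j: "nat \<bar>j\<bar> \<le> M" by auto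
    have "of_int \<bar>j\<bar> = real (nat \<bar>j\<bar>)" by simp
    then have e: "a (nat \<bar>j\<bar>) = a (Suc M)
        + (a M - a (Suc M)) * max 0 (real (Suc M) - of_int \<bar>j\<bar>)
        + (\<Sum>r=1..M. D r * max 0 (real r - of_int \<bar>j\<bar>))"
      using convex_sequence_expand[OF j, of a] j unfolding D_def
      by (simp add: max_absorb2 mult_ac)
    show "of_real (a (nat \<bar>j\<bar>)) * c j * cis (of_int j * x) = (of_real (a (Suc M)) * c j
          + of_real (a M - a (Suc M)) * (of_real (max 0 (real (Suc M) - of_int \<bar>j\<bar>)) * c j)
          + (\<Sum>r=1..M. of_real (D r) * (of_real (max 0 (real r - of_int \<bar>j\<bar>)) * c j)))
          * cis (of_int j * x)"
      unfolding e by (simp add: ring_distribs sum_distrib_right mult.assoc)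
  qed
  also have "\<dots> = of_real (a (Suc M)) * trig_poly M c x
      + of_real (a M - a (Suc M)) * F (Suc M) + (\<Sum>r=1..M. of_real (D r) * F r)"
    unfolding F_def by (simp only: trig_poly_scale trig_poly_add trig_poly_sum)
  also have "norm \<dots> \<le> a (Suc M) * B + (a M - a (Suc M)) * (real (Suc M) * B)
      + (\<Sum>r=1..M. D r * (real r * B))"
  proof (intro order_trans[OF norm_triangle_ineq] add_mono sum_norm_le)
    show "norm (of_real (a (Suc M)) * trig_poly M c x) \<le> a (Suc M) * B"
      using nonneg B by (simp add: norm_mult mult_left_mono)
    show "norm (of_real (a M - a (Suc M)) * F (Suc M)) \<le> (a M - a (Suc M)) * (real (Suc M) * B)"
      using decr F[of "Suc M"] by (simp add: norm_mult mult_left_mono del: of_real_diff)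
    show "norm (of_real (D r) * F r) \<le> D r * (real r * B)" if "r \<in> {1..M}" for r
    proof -
      have "D r \<ge> 0" using convex[of r] that by (simp add: D_def)
      then show ?thesis using F[of r] by (simp add: norm_mult mult_left_mono)
    qed
  qed
  also have "\<dots> = a 0 * B"
    using convex_sequence_expand[of 0 M a]
    by (simp add: D_def ring_distribs sum_distrib_left sum_distrib_right sum.distrib mult_ac)
  finally show ?thesis .
qed

subsection \<open>Density of trigonometric polynomials\<close>

definition trig_set :: "(real \<Rightarrow> complex) set" where
  "trig_set = (\<Union>M. trig_polys M)"

lemma trig_poly_in_trig_set: "trig_poly M c \<in> trig_set"
  by (auto simp: trig_set_def trig_polys_eq)

lemma trig_set_add:
  assumes "f \<in> trig_set" "g \<in> trig_set"
  shows "(\<lambda>x. f x + g x) \<in> trig_set"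
proof -
  obtain M M' where "f \<in> trig_polys M" "g \<in> trig_polys M'"
    using assms by (auto simp: trig_set_def)
  then have "f \<in> trig_polys (max M M')" "g \<in> trig_polys (max M M')"
    using trig_polys_mono by (meson max.cobounded1 max.cobounded2 subsetD)+
  then have "(\<lambda>x. f x + g x) \<in> trig_polys (max M M')"
    by (auto simp: trig_polys_eq trig_poly_add)
  then show ?thesis by (auto simp: trig_set_def)
qed

lemma trig_set_scale: "f \<in> trig_set \<Longrightarrow> (\<lambda>x. b * f x) \<in> trig_set"
  unfolding trig_set_def trig_polys_eq by (clarsimp simp: trig_poly_scale) blast

lemma trig_set_monomial: "(\<lambda>x. cis (of_int i * x)) \<in> trig_set"
proof -
  have "(\<lambda>x. cis (of_int i * x)) = trig_poly (nat \<bar>i\<bar>) (\<lambda>j. if j = i then 1 else 0)"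
    by (simp add: trig_poly_def fun_eq_iff if_distrib[of "\<lambda>b. b * _"] cong: if_cong)
       (auto simp: abs_if)
  then show ?thesis by (simp add: trig_poly_in_trig_set)
qed

lemma trig_set_const: "(\<lambda>x. b) \<in> trig_set"
  using trig_set_scale[OF trig_set_monomial[of 0], of b] by simp

lemma trig_set_sum:
  "(\<And>i. i \<in> I \<Longrightarrow> f i \<in> trig_set) \<Longrightarrow> (\<lambda>x. \<Sum>i\<in>I. f i x) \<in> trig_set"
  by (induction I rule: infinite_finite_induct) (simp_all add: trig_set_const trig_set_add)

lemma trig_set_mult:
  assumes "f \<in> trig_set" "g \<in> trig_set"
  shows "(\<lambda>x. f x * g x) \<in> trig_set"
proof -
  obtain M c M' c' where fg: "f = trig_poly M c" "g = trig_poly M' c'"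
    using assms by (auto simp: trig_set_def trig_polys_eq)
  have "(\<lambda>x. f x * g x) = (\<lambda>x. \<Sum>j=-int M..int M. \<Sum>j'=-int M'..int M'.
          (c j * c' j') * cis (of_int (j + j') * x))"
    unfolding fg trig_poly_def sum_product
    by (intro ext sum.cong refl) (simp add: ring_distribs cis_mult [symmetric] mult_ac)
  then show ?thesis
    by (simp only: trig_set_sum trig_set_scale trig_set_monomial)
qed

lemma real_polynomial_cis_trig:
  fixes p :: "complex \<Rightarrow> real"
  assumes "real_polynomial_function p"
  shows "(\<lambda>x. of_real (p (cis x))) \<in> trig_set"
  using assms
proof induction
  case (linear p)
  \<comment> \<open>Euler's formulas for cosine and sine, inserted into the real-linear form
    \<open>p\<close>, which is determined by its values at 1 and \<open>\<i>\<close>.\<close>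
  have "of_real (p (cis x)) = of_real (p 1) / 2 * (cis x + cis (- x))
      + of_real (p \<i>) / (2 * \<i>) * (cis x + (-1) * cis (- x))" for x
  proof -
    have "cis x = cos x *\<^sub>R 1 + sin x *\<^sub>R \<i>"
      by (simp add: complex_eq_iff)
    then have "p (cis x) = cos x * p 1 + sin x * p \<i>"
      using linear by (simp add: bounded_linear.linear linear_add linear_scale)
    then show ?thesis
      by (simp add: complex_eq_iff)
  qed
  moreover have "(\<lambda>x. cis x) \<in> trig_set" "(\<lambda>x. cis (- x)) \<in> trig_set"
    using trig_set_monomial[of 1] trig_set_monomial[of "-1"] by simp_all
  ultimately show ?case
    by (simp only: trig_set_add trig_set_scale)
qed (simp_all add: trig_set_const trig_set_add trig_set_mult)

lemma CT_cis_cong: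
  assumes "f \<in> CT" "cis s = cis t"
  shows "f s = f t"
proof -
  interpret periodic_fun_simple f "2 * pi"
    by unfold_locales (use assms(1) in \<open>simp add: CT_def\<close>)
  have "sin s = sin t \<and> cos s = cos t"
    using assms(2) by (simp add: complex_eq_iff)
  then obtain i :: int where "s = t + 2 * pi * of_int i"
    by (auto simp: sin_cos_eq_iff)
  then show ?thesis
    using plus_of_int[of t i] by (simp add: mult_ac)
qed

text \<open>\<open>Arg\<close> jumps at -1, so continuity does not follow by composition. Instead,
  the preimage of a closed set is written as the image under \<open>cis\<close> of a closed subset
  of $[-\<pi>, \<pi>]$; this image is compact, hence closed.\<close>

lemma continuous_on_circle_lift:
  assumes "f \<in> CT"
  shows "continuous_on (sphere 0 1) (\<lambda>z. f (Arg z))"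
  unfolding continuous_on_closed_vimage[OF closed_sphere]
proof (intro allI impI)
  fix B :: "complex set" assume "closed B"
  have lift: "f (Arg (cis t)) = f t" for t
    using assms by (rule CT_cis_cong) (simp add: cis_Arg)
  have "(\<lambda>z. f (Arg z)) -` B \<inter> sphere 0 1 = cis ` ({-pi..pi} \<inter> f -` B)"
  proof (intro set_eqI iffI)
    fix z assume z: "z \<in> (\<lambda>z. f (Arg z)) -` B \<inter> sphere 0 1"
    then have "norm z = 1" by simp
    then have "cis (Arg z) = z"
      by (subst cis_Arg) (auto simp: sgn_div_norm)
    with z show "z \<in> cis ` ({-pi..pi} \<inter> f -` B)"
      using Arg_bounded[of z] by (auto intro!: image_eqI[of z cis "Arg z"])
  qed (auto simp: lift)
  moreover have "compact (cis ` ({-pi..pi} \<inter> f -` B))"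
  proof (intro compact_continuous_image compact_Int_closed)
    show "closed (f -` B)"
      using assms \<open>closed B\<close> by (auto simp: CT_def intro: continuous_closed_vimage
          continuous_on_eq_continuous_at[THEN iffD1, OF open_UNIV, rule_format])
  qed (auto intro!: continuous_intros)
  ultimately show "closed ((\<lambda>z. f (Arg z)) -` B \<inter> sphere 0 1)"
    by (simp add: compact_imp_closed)
qed

text \<open>Stone-Weierstrass on the unit circle in the plane, applied to the lift of
  \<open>f\<close>. The approximant has real polynomial functions as real and imaginary parts, and
  these become trigonometric polynomials along \<open>cis\<close>.\<close>

theorem trig_poly_dense:
  assumes "f \<in> CT" "e > 0"
  obtains M c where "\<And>x. norm (f x - trig_poly M c x) \<le> e"
proof -
  obtain g where g: "polynomial_function g"
      and close: "\<And>z. z \<in> sphere 0 1 \<Longrightarrow> norm (f (Arg z) - g z) < e"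
    using Stone_Weierstrass_polynomial_function[OF compact_sphere
        continuous_on_circle_lift[OF assms(1)] assms(2)] by blast
  have "(\<lambda>x. of_real ((Re \<circ> g) (cis x)) + \<i> * of_real ((Im \<circ> g) (cis x))) \<in> trig_set"
    using g bounded_linear_Re bounded_linear_Im unfolding polynomial_function_def
    by (intro trig_set_add trig_set_scale real_polynomial_cis_trig) blast+
  also have "(\<lambda>x. of_real ((Re \<circ> g) (cis x)) + \<i> * of_real ((Im \<circ> g) (cis x))) = (\<lambda>x. g (cis x))"
    by (simp add: complex_eq_iff fun_eq_iff)
  finally obtain M c where Mc: "(\<lambda>x. g (cis x)) = trig_poly M c"
    by (auto simp: trig_set_def trig_polys_eq)
  have "norm (f x - trig_poly M c x) \<le> e" for x
  proof -
    have "f (Arg (cis x)) = f x"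
      using assms(1) by (rule CT_cis_cong) (simp add: cis_Arg)
    then show ?thesis
      using close[of "cis x"] fun_cong[OF Mc, of x] by simp
  qed
  then show ?thesis by (rule that)
qed

subsection \<open>Averaged differences\<close>

lemma sum_symmetric:
  fixes F :: "nat \<Rightarrow> 'a::comm_monoid_add"
  shows "(\<Sum>i=0..2*k. F i) = F k + (\<Sum>l=1..k. F (k + l) + F (k - l))"
proof -
  have "{0..2*k} = {0..<k} \<union> insert k {k+1..2*k}" by auto
  then have "(\<Sum>i=0..2*k. F i) = (\<Sum>i\<in>{0..<k}. F i) + (F k + (\<Sum>i=k+1..2*k. F i))"
    by (simp only:, subst sum.union_disjoint) auto
  also have "(\<Sum>i\<in>{0..<k}. F i) = (\<Sum>l=1..k. F (k - l))"
    by (rule sum.reindex_bij_witness[of _ "\<lambda>l. k - l" "\<lambda>l. k - l"]) auto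
  also have "(\<Sum>i=k+1..2*k. F i) = (\<Sum>l=1..k. F (k + l))"
    by (rule sum.reindex_bij_witness[of _ "\<lambda>l. k + l" "\<lambda>l. l - k"]) auto
  finally show ?thesis by (simp add: sum.distrib ac_simps)
qed

text \<open>Normalised and signed so that, up to a factor of modulus
  \<open>real ((2 * k) choose k)\<close>, the central difference is \<open>f x\<close> minus a
  combination of symmetric translates. Averaging that combination over the step produces the
  operator $U$.\<close>

definition diff_coeff :: "nat \<Rightarrow> nat \<Rightarrow> real" where
  "diff_coeff k l = (-1) ^ Suc l * real ((2 * k) choose (k + l)) / real ((2 * k) choose k)"

lemma central_diff_even:
  "central_diff (2 * k) t f x = (-1) ^ k * of_nat ((2 * k) choose k) *
     (f x - (\<Sum>l=1..k. of_real (diff_coeff k l) * (f (x + real l * t) + f (x - real l * t))))"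
proof -
  define C where "C = real ((2 * k) choose k)"
  have "C \<noteq> 0" by (simp add: C_def)
  define F where "F i = (-1) ^ (2 * k - i) * of_nat ((2 * k) choose i)
      * f (x - real (2 * k) / 2 * t + real i * t)" for i
  have F: "F (k + l) + F (k - l) = (-1) ^ k * of_real C *
      - (of_real (diff_coeff k l) * (f (x + real l * t) + f (x - real l * t)))"
    if l: "l \<in> {1..k}" for l
  proof -
    \<comment> \<open>Writing $k = l + m$ removes the truncated subtractions: both exponents, $k -
      l$ and $k + l$, have the parity of $k + l$.\<close>
    obtain m where "k = l + m"
      using l le_Suc_ex[of l k] by auto
    then have sgn: "(-1 :: complex) ^ (2 * k - (k + l)) = (-1) ^ (k + l)"
        "(-1 :: complex) ^ (2 * k - (k - l)) = (-1) ^ (k + l)"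
      by (simp_all add: minus_one_power_iff)
    have bin: "(2 * k) choose (k - l) = (2 * k) choose (k + l)"
      using that by (subst binomial_symmetric) (auto simp: mult_2)
    have arg: "x - real (2 * k) / 2 * t + real (k + l) * t = x + real l * t"
        "x - real (2 * k) / 2 * t + real (k - l) * t = x - real l * t"
      using that by (simp_all add: of_nat_diff algebra_simps)
    have coeff: "of_real C * of_real (diff_coeff k l) =
        - ((-1) ^ l * complex_of_nat ((2 * k) choose (k + l)))"
      using \<open>C \<noteq> 0\<close> by (simp add: diff_coeff_def C_def)
    have "F (k + l) + F (k - l) = (-1) ^ k * ((-1) ^ l * of_nat ((2 * k) choose (k + l)))
        * (f (x + real l * t) + f (x - real l * t))"
      unfolding F_def sgn bin arg by (simp add: power_add algebra_simps)
    also have "(-1) ^ l * of_nat ((2 * k) choose (k + l)) =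
        - (of_real C * complex_of_real (diff_coeff k l))"
      using coeff by simp
    finally show ?thesis by (simp add: mult_ac)
  qed
  have "central_diff (2 * k) t f x = F k + (\<Sum>l=1..k. F (k + l) + F (k - l))"
    unfolding central_diff_def F_def by (rule sum_symmetric)
  also have "F k = (-1) ^ k * of_real C * f x"
  proof -
    have "x - real (2 * k) / 2 * t + real k * t = x" "2 * k - k = k" by simp_all
    then show ?thesis unfolding F_def C_def by simp
  qed
  also have "(\<Sum>l=1..k. F (k + l) + F (k - l)) = (\<Sum>l=1..k. (-1) ^ k * of_real C *
      - (of_real (diff_coeff k l) * (f (x + real l * t) + f (x - real l * t))))"
    by (rule sum.cong[OF refl F])
  finally show ?thesis
    by (simp only: C_def of_real_of_nat_eq right_diff_distrib sum_distrib_left sum_negf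
        mult_minus_right add_uminus_conv_diff)
qed

lemma norm_central_diff_le:
  assumes "\<And>x. norm (f x) \<le> B"
  shows "norm (central_diff m h f x) \<le> 2 ^ m * B"
proof -
  have "norm (central_diff m h f x) \<le> (\<Sum>i=0..m. real (m choose i) * B)"
    unfolding central_diff_def
    by (intro sum_norm_le) (simp add: norm_mult norm_power mult_left_mono assms)
  also have "\<dots> = real (\<Sum>i\<le>m. m choose i) * B"
    by (simp add: sum_distrib_right atMost_atLeast0)
  finally show ?thesis by (simp add: choose_row_sum)
qed

lemma central_diff_diff:
  "central_diff m h (\<lambda>x. f x - g x) x = central_diff m h f x - central_diff m h g x"
  by (simp add: central_diff_def sum_subtractf right_diff_distrib)

lemma norm_central_diff_le_modulus:
  assumes "f \<in> CT" "x \<in> circle" "\<bar>h\<bar> < \<delta>"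
  shows "norm (central_diff m h f x) \<le> modulus_smoothness m f \<delta>"
  unfolding modulus_smoothness_def
  using cSUP_upper[OF _ bdd_above_central_diff[OF assms(1), of m], of "(x, h)"] assms(2,3)
  by auto

lemma modulus_smoothness_perturb:
  assumes "f \<in> CT" "\<delta> > 0" "\<And>x. norm (g x - f x) \<le> e"
  shows "modulus_smoothness m g \<delta> \<le> modulus_smoothness m f \<delta> + 2 ^ m * e"
proof -
  have "norm (central_diff m h g x) \<le> modulus_smoothness m f \<delta> + 2 ^ m * e"
    if "x \<in> circle" "\<bar>h\<bar> < \<delta>" for x h
    using norm_central_diff_le_modulus[OF assms(1) that, of m]
      norm_central_diff_le[of "\<lambda>x. g x - f x", OF assms(3), of m h x]
      norm_triangle_sub[of "central_diff m h g x" "central_diff m h f x"]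
    by (simp add: central_diff_diff)
  moreover have "(- pi, 0) \<in> {(x, h). x \<in> circle \<and> \<bar>h\<bar> < \<delta>}"
    using assms(2) by (simp add: circle_def)
  ultimately have "(SUP (x, h)\<in>{(x, h). x \<in> circle \<and> \<bar>h\<bar> < \<delta>}. norm (central_diff m h g x))
      \<le> modulus_smoothness m f \<delta> + 2 ^ m * e"
    by (intro cSUP_least) (blast, force)
  then show ?thesis
    by (simp only: modulus_smoothness_def)
qed

text \<open>A probability density on $[0, h]$. Its linear decay to 0 gives the cosine transform an
  exact factor $1/y^2$, which is later split off from the multiplier of $U$.\<close>

definition hat_weight :: "real \<Rightarrow> real \<Rightarrow> real" where
  "hat_weight h t = 2 * (h - t) / h\<^sup>2"

text \<open>Half of it is the Fourier transform of the hat function $\max(0, h - |t|) / h^2$.\<close>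

definition hat_transform :: "real \<Rightarrow> real \<Rightarrow> real" where
  "hat_transform h y = (if y = 0 then 2 else 2 / h\<^sup>2 * (2 - 2 * cos (y * h)) / y\<^sup>2)"

lemma hat_weight_has_integral:
  assumes "h > 0"
  shows "(hat_weight h has_integral 1) {0..h}"
proof -
  have "(hat_weight h has_integral
      (2 * h * h - h\<^sup>2) / h\<^sup>2 - (2 * h * 0 - 0\<^sup>2) / h\<^sup>2) {0..h}"
    unfolding hat_weight_def [abs_def] using assms
    by (intro fundamental_theorem_of_calculus)
       (auto intro!: derivative_eq_intros
          simp flip: has_real_derivative_iff_has_vector_derivative simp: field_simps)
  then show ?thesis using assms by (simp add: power2_eq_square)
qed

lemma hat_transform_has_integral:
  assumes "h > 0"
  shows "((\<lambda>t. hat_weight h t * (2 * cos (y * t))) has_integral hat_transform h y) {0..h}"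
proof (cases "y = 0")
  case True
  then show ?thesis
    using has_integral_mult_left[OF hat_weight_has_integral[OF assms], of 2]
    by (simp add: hat_transform_def)
next
  case False
  \<comment> \<open>An antiderivative found by integrating by parts once.\<close>
  define G where "G t = 4 / h\<^sup>2 * ((h - t) * sin (y * t) / y - cos (y * t) / y\<^sup>2)" for t
  have "(G has_real_derivative hat_weight h t * (2 * cos (y * t))) (at t within {0..h})" for t
    unfolding G_def hat_weight_def using False assms
    by (auto intro!: derivative_eq_intros simp: field_simps power2_eq_square)
  then have "((\<lambda>t. hat_weight h t * (2 * cos (y * t))) has_integral G h - G 0) {0..h}"
    using assms by (intro fundamental_theorem_of_calculus)
      (auto simp flip: has_real_derivative_iff_has_vector_derivative)
  also have "G h - G 0 = hat_transform h y"
    using False assms by (simp add: G_def hat_transform_def field_simps)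
  finally show ?thesis .
qed

text \<open>The multiplier of $U$.\<close>

definition smooth_mult :: "nat \<Rightarrow> real \<Rightarrow> int \<Rightarrow> real" where
  "smooth_mult k h j = (\<Sum>l=1..k. diff_coeff k l * hat_transform h (of_int j * real l))"

text \<open>For fixed $t$ the bracket is itself a Fourier multiplier, with value \<open>1 -
  (\<Sum>l=1..k. diff_coeff k l * (2 * cos (of_int j * real l * t)))\<close> at frequency $j$. As
  \<open>p\<close> is a finite sum, it suffices to integrate these values one frequency at a
  time.\<close>

lemma averaged_difference:
  fixes M :: nat and d :: "int \<Rightarrow> complex"
  assumes "h > 0"
  defines "p \<equiv> trig_poly M d"
  shows "((\<lambda>t. of_real (hat_weight h t) * (p x - (\<Sum>l=1..k. of_real (diff_coeff k l) *
             (p (x + real l * t) + p (x - real l * t)))))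
          has_integral p x - trig_poly M (\<lambda>j. of_real (smooth_mult k h j) * d j) x) {0..h}"
proof -
  define m where "m j t = hat_weight h t *
      (1 - (\<Sum>l=1..k. diff_coeff k l * (2 * cos (of_int j * real l * t))))" for j t
  have "((\<lambda>t. hat_weight h t - (\<Sum>l=1..k. diff_coeff k l *
      (hat_weight h t * (2 * cos (of_int j * real l * t))))) has_integral
      1 - smooth_mult k h j) {0..h}" for j
    unfolding smooth_mult_def
    by (intro has_integral_diff has_integral_sum has_integral_mult_right
        hat_weight_has_integral hat_transform_has_integral assms) auto
  then have m: "(m j has_integral 1 - smooth_mult k h j) {0..h}" for j
    by (rule has_integral_eq[rotated])
       (simp add: m_def right_diff_distrib sum_distrib_left mult_ac)
  have "((\<lambda>t. \<Sum>j=-int M..int M. m j t *\<^sub>R (d j * cis (of_int j * x)))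
      has_integral (\<Sum>j=-int M..int M. (1 - smooth_mult k h j) *\<^sub>R (d j * cis (of_int j * x))))
      {0..h}"
    by (intro has_integral_sum has_integral_scaleR_left m) auto
  also have "(\<Sum>j=-int M..int M. (1 - smooth_mult k h j) *\<^sub>R (d j * cis (of_int j * x)))
      = p x - trig_poly M (\<lambda>j. of_real (smooth_mult k h j) * d j) x"
    unfolding p_def trig_poly_diff by (simp add: trig_poly_def scaleR_conv_of_real algebra_simps)
  also have "(\<lambda>t. \<Sum>j=-int M..int M. m j t *\<^sub>R (d j * cis (of_int j * x)))
      = (\<lambda>t. of_real (hat_weight h t) * (p x - (\<Sum>l=1..k. of_real (diff_coeff k l) *
             (p (x + real l * t) + p (x - real l * t)))))"
    unfolding p_def trig_poly_sym_sum trig_poly_scale trig_poly_sum trig_poly_diff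
    unfolding trig_poly_def m_def
    by (intro ext sum.cong refl)
       (simp add: scaleR_conv_of_real left_diff_distrib right_diff_distrib sum_distrib_right
          sum_distrib_left mult_ac)
  finally show ?thesis .
qed

lemma averaged_difference_bound:
  fixes M :: nat and d :: "int \<Rightarrow> complex"
  assumes "h > 0" "x \<in> circle"
  defines "p \<equiv> trig_poly M d"
  shows "norm (p x - trig_poly M (\<lambda>j. of_real (smooth_mult k h j) * d j) x)
    \<le> modulus_smoothness (2 * k) p h / real ((2 * k) choose k)"
proof -
  define C where "C = real ((2 * k) choose k)"
  have "C > 0" by (simp add: C_def)
  define D where "D t = p x - (\<Sum>l=1..k. of_real (diff_coeff k l) *
             (p (x + real l * t) + p (x - real l * t)))" for t
  have int: "((\<lambda>t. of_real (hat_weight h t) * D t) has_integral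
      p x - trig_poly M (\<lambda>j. of_real (smooth_mult k h j) * d j) x) {0..h}"
    unfolding D_def p_def by (rule averaged_difference[OF assms(1)])
  have bnd: "((\<lambda>t. hat_weight h t * (modulus_smoothness (2 * k) p h / C)) has_integral
      1 * (modulus_smoothness (2 * k) p h / C)) {0..h}"
    by (intro has_integral_mult_left hat_weight_has_integral assms)
  have "norm (of_real (hat_weight h t) * D t) \<le> hat_weight h t * (modulus_smoothness (2 * k) p h / C)"
    if "t \<in> {0..h}" for t
  proof (cases "t = h")
    \<comment> \<open>The modulus admits only steps strictly smaller than $h$; at the endpoint the
      weight vanishes instead.\<close>
    case True
    then show ?thesis by (simp add: hat_weight_def)
  next
    case False
    have "C * norm (D t) = norm (central_diff (2 * k) t p x)"
      by (simp add: central_diff_even D_def C_def norm_mult norm_power)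
    also have "\<dots> \<le> modulus_smoothness (2 * k) p h"
      using False that assms(2) by (intro norm_central_diff_le_modulus)
        (auto simp: p_def trig_poly_in_CT)
    finally have "norm (D t) \<le> modulus_smoothness (2 * k) p h / C"
      using \<open>C > 0\<close> by (simp add: field_simps)
    moreover have "hat_weight h t \<ge> 0"
      using that by (simp add: hat_weight_def)
    ultimately have "hat_weight h t * norm (D t) \<le> hat_weight h t * (modulus_smoothness (2 * k) p h / C)"
      by (rule mult_left_mono)
    then show ?thesis
      using \<open>hat_weight h t \<ge> 0\<close> by (simp add: norm_mult)
  qed
  then have "norm (integral {0..h} (\<lambda>t. of_real (hat_weight h t) * D t))
      \<le> integral {0..h} (\<lambda>t. hat_weight h t * (modulus_smoothness (2 * k) p h / C))"
    using int bnd by (intro integral_norm_bound_integral) (auto simp: has_integral_integrable)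
  then show ?thesis
    unfolding integral_unique[OF int] integral_unique[OF bnd] by (simp add: C_def)
qed

section \<open>Norm bound for the second-difference operator $V$\<close>

lemma alternating_sum_bounds:
  fixes c :: "nat \<Rightarrow> real"
  assumes "decseq c" "\<And>l. c l \<ge> 0"
  shows "0 \<le> (\<Sum>l<m. (-1) ^ l * c l) \<and> (\<Sum>l<m. (-1) ^ l * c l) \<le> c 0"
  using assms
proof (induction m arbitrary: c)
  case (Suc m)
  have "decseq (\<lambda>l. c (Suc l))"
    using Suc.prems(1) by (simp add: decseq_def)
  then have "0 \<le> (\<Sum>l<m. (-1) ^ l * c (Suc l)) \<and> (\<Sum>l<m. (-1) ^ l * c (Suc l)) \<le> c 1"
    using Suc.IH[of "\<lambda>l. c (Suc l)"] Suc.prems(2) by simp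
  \<comment> \<open>Leibniz argument: after the first term, an alternating sum of the shifted
    sequence is subtracted, and it lies between 0 and \<open>c 1\<close>.\<close>
  moreover have "(\<Sum>l<Suc m. (-1) ^ l * c l) = c 0 - (\<Sum>l<m. (-1) ^ l * c (Suc l))"
    by (simp add: sum.lessThan_Suc_shift sum_negf del: sum.lessThan_Suc)
  moreover have "c 1 \<le> c 0"
    using Suc.prems(1) by (simp add: decseq_def)
  ultimately show ?case by linarith
qed simp

lemma central_ratio_bounds:
  "real ((2 * k) choose (k + l)) / real ((2 * k) choose k) \<in> {0..1}"
  using binomial_maximum'[of k "k + l"] by (simp add: mult_2)

lemma sum_inverse_squares_le: "(\<Sum>l<m. 1 / (real (Suc l))\<^sup>2) \<le> pi\<^sup>2 / 6"
proof -
  have sums: "(\<lambda>l. 1 / (real (Suc l))\<^sup>2) sums (pi\<^sup>2 / 6)"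
    using inverse_squares_sums by simp
  have "(\<Sum>l<m. 1 / (real (Suc l))\<^sup>2) \<le> (\<Sum>l. 1 / (real (Suc l))\<^sup>2)"
    using sums_summable[OF sums] by (rule sum_le_suminf) auto
  then show ?thesis
    by (simp only: sums_unique[OF sums, symmetric])
qed

text \<open>The terms alternate in sign, and their absolute values decrease and are at most $1/l^2$.
  Hence the signed sum is controlled by its first term and the absolute sum by the Basel
  series.\<close>

lemma diff_coeff_over_square_bounds:
  defines "\<beta> \<equiv> \<lambda>k l. diff_coeff k l / (real l)\<^sup>2"
  shows "\<bar>\<Sum>l=1..k. \<beta> k l\<bar> \<le> 1" and "(\<Sum>l=1..k. \<bar>\<beta> k l\<bar>) \<le> pi\<^sup>2 / 6"
proof -
  define a where "a l = real ((2 * k) choose (k + l)) / real ((2 * k) choose k)" for l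
  define c where "c l = a (Suc l) / (real (Suc l))\<^sup>2" for l
  have a: "0 \<le> a l" "a l \<le> 1" for l
    using central_ratio_bounds[of k l] by (simp_all add: a_def)
  have "a (Suc l) \<le> a l" for l
  proof -
    have "(2 * k) choose (k + Suc l) \<le> (2 * k) choose (k + l)"
      by (cases "k + Suc l \<le> 2 * k") (auto intro: binomial_antimono simp: binomial_eq_0)
    then show ?thesis by (simp add: a_def divide_right_mono del: add_Suc_right)
  qed
  then have "c (Suc l) \<le> c l" for l
    unfolding c_def using a by (intro frac_le power_mono) auto
  then have "decseq c" by (rule decseq_SucI)
  have shift: "(\<Sum>l=1..k. g l) = (\<Sum>l<k. g (Suc l))" for g :: "nat \<Rightarrow> real"
    by (simp add: sum.atLeast1_atMost_eq)
  have \<beta>: "\<beta> k (Suc l) = (-1) ^ l * c l" for l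
    by (simp add: \<beta>_def c_def a_def diff_coeff_def)
  have c0: "c l \<ge> 0" for l by (simp add: c_def a)
  have "c 0 \<le> 1" by (simp add: c_def a)
  then show "\<bar>\<Sum>l=1..k. \<beta> k l\<bar> \<le> 1"
    using alternating_sum_bounds[OF \<open>decseq c\<close> c0, of k] unfolding shift \<beta> by linarith
  have "(\<Sum>l=1..k. \<bar>\<beta> k l\<bar>) = (\<Sum>l<k. c l)"
    unfolding shift \<beta> by (simp add: abs_mult power_abs c0)
  also have "\<dots> \<le> (\<Sum>l<k. 1 / (real (Suc l))\<^sup>2)"
    unfolding c_def using a by (intro sum_mono divide_right_mono) auto
  also have "\<dots> \<le> pi\<^sup>2 / 6"
    by (rule sum_inverse_squares_le)
  finally show "(\<Sum>l=1..k. \<bar>\<beta> k l\<bar>) \<le> pi\<^sup>2 / 6" .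
qed

text \<open>The seventh partial sum of the Basel series is the first one to exceed $3/2$.\<close>

lemma pi_squared_ge_9: "pi\<^sup>2 \<ge> 9"
  using sum_inverse_squares_le[of 7] by (simp add: eval_nat_numeral)

text \<open>The multiplier of $V$.\<close>

definition diff_mult :: "nat \<Rightarrow> real \<Rightarrow> int \<Rightarrow> real" where
  "diff_mult k h j = 2 / h\<^sup>2 *
     (\<Sum>l=1..k. diff_coeff k l / (real l)\<^sup>2 * (2 - 2 * cos (of_int j * (real l * h))))"

text \<open>The factor $1/(j l)^2$ of \<open>hat_transform\<close> splits: $1/l^2$ joins the
  coefficients of $V$, and $1/j^2$ is left to be imitated by $R$.\<close>

lemma smooth_mult_eq_diff_mult:
  assumes "j \<noteq> 0"
  shows "smooth_mult k h j = diff_mult k h j / (of_int j)\<^sup>2"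
  unfolding smooth_mult_def diff_mult_def sum_distrib_left sum_divide_distrib
  using assms by (intro sum.cong refl) (auto simp: hat_transform_def power_mult_distrib mult_ac)

lemma diff_mult_bound:
  assumes "h > 0" and B: "\<And>x. norm (trig_poly M c x) \<le> B"
  shows "norm (trig_poly M (\<lambda>j. of_real (diff_mult k h j) * c j) x)
    \<le> 4 / h\<^sup>2 * (pi\<^sup>2 / 6 + 1) * B"
proof -
  define \<beta> where "\<beta> l = diff_coeff k l / (real l)\<^sup>2" for l
  define g where "g = trig_poly M c"
  have \<beta>: "\<bar>\<Sum>l=1..k. \<beta> l\<bar> \<le> 1" "(\<Sum>l=1..k. \<bar>\<beta> l\<bar>) \<le> pi\<^sup>2 / 6"
    unfolding \<beta>_def by (rule diff_coeff_over_square_bounds)+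
  have "B \<ge> 0" using B norm_ge_zero order_trans by blast
  have "trig_poly M (\<lambda>j. of_real (diff_mult k h j) * c j) x =
      of_real (2 / h\<^sup>2) * (\<Sum>l=1..k. of_real (\<beta> l) *
        (2 * g x - (g (x + real l * h) + g (x - real l * h))))"
    unfolding g_def trig_poly_sym_sum trig_poly_scale trig_poly_diff trig_poly_sum
    by (simp add: diff_mult_def \<beta>_def trig_poly_def sum_distrib_left sum_distrib_right
        left_diff_distrib right_diff_distrib mult_ac)
  \<comment> \<open>Collecting the terms in \<open>g x\<close> before taking norms uses the
    cancellation in the signed sum. Bounding each second difference separately would give
    \<open>pi\<^sup>2 / 3\<close> in place of \<open>pi\<^sup>2 / 6 + 1\<close>.\<close>
  also have "\<dots> = of_real (2 / h\<^sup>2) * (of_real (\<Sum>l=1..k. \<beta> l) * (2 * g x)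
      - (\<Sum>l=1..k. of_real (\<beta> l) * (g (x + real l * h) + g (x - real l * h))))"
    by (simp add: right_diff_distrib sum_subtractf sum_distrib_right)
  also have "norm \<dots> \<le> 2 / h\<^sup>2 * (1 * (2 * B) + pi\<^sup>2 / 6 * (2 * B))"
  proof -
    have "norm (of_real (\<Sum>l=1..k. \<beta> l) * (2 * g x)) \<le> 1 * (2 * B)"
      unfolding norm_mult norm_of_real using \<beta>(1) B[of x] by (intro mult_mono) (auto simp: g_def)
    moreover have "norm (\<Sum>l=1..k. of_real (\<beta> l) * (g (x + real l * h) + g (x - real l * h)))
        \<le> (\<Sum>l=1..k. \<bar>\<beta> l\<bar> * (2 * B))"
    proof (intro sum_norm_le)
      fix l
      have "norm (g (x + real l * h) + g (x - real l * h)) \<le> 2 * B"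
        using norm_triangle_ineq[of "g (x + real l * h)" "g (x - real l * h)"]
          B[of "x + real l * h"] B[of "x - real l * h"] by (simp add: g_def)
      then show "norm (of_real (\<beta> l) * (g (x + real l * h) + g (x - real l * h))) \<le> \<bar>\<beta> l\<bar> * (2 * B)"
        unfolding norm_mult norm_of_real by (intro mult_left_mono) auto
    qed
    moreover have "(\<Sum>l=1..k. \<bar>\<beta> l\<bar> * (2 * B)) \<le> pi\<^sup>2 / 6 * (2 * B)"
      unfolding sum_distrib_right[symmetric] using \<beta>(2) \<open>B \<ge> 0\<close> by (intro mult_right_mono) auto
    ultimately show ?thesis
      unfolding norm_mult[of "of_real (2 / h\<^sup>2)"] norm_of_real
      by (intro mult_mono order_trans[OF norm_triangle_ineq4]) auto
  qed
  finally show ?thesis by (simp add: algebra_simps)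
qed

subsection \<open>The convex inverse-square multiplier\<close>

text \<open>Below $N$ this is the tangent line of $1/x^2$ at $N$. The tangent keeps the sequence
  convex across $N$ and has the value $3/N^2$ at 0.\<close>

definition tail_mult :: "nat \<Rightarrow> nat \<Rightarrow> real" where
  "tail_mult N j = (if j \<le> N then 3 / (real N)\<^sup>2 - 2 * real j / real N ^ 3 else 1 / (real j)\<^sup>2)"

lemma tail_mult_ge:
  assumes "N \<ge> 1" "j \<ge> N"
  shows "tail_mult N j = 1 / (real j)\<^sup>2"
proof (cases "j = N")
  case True
  have "2 * real N / real N ^ 3 = 2 / (real N)\<^sup>2"
    using assms by (simp add: field_simps power2_eq_square power3_eq_cube)
  then show ?thesis
    using True by (simp add: tail_mult_def diff_divide_distrib[symmetric])
qed (use assms in \<open>simp add: tail_mult_def\<close>)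

text \<open>Left of $N$ the sequence is linear. At $N$ the claim says that the tangent, continued to
  $N + 1$, stays below $1/x^2$. To the right it is the convexity of $1/x^2$.\<close>

lemma tail_mult_convex:
  assumes "N \<ge> 1" "r \<ge> 1"
  shows "2 * tail_mult N r \<le> tail_mult N (r - 1) + tail_mult N (Suc r)"
proof -
  consider "r < N" | "r = N" | "r > N" by linarith
  then show ?thesis
  proof cases
    case 1
    then have "r - 1 \<le> N" by simp
    with 1 show ?thesis
      using assms by (simp add: tail_mult_def of_nat_diff add_divide_distrib diff_divide_distrib
          right_diff_distrib)
  next
    case 2
    define y where "y = real N"
    have "y \<ge> 1" using assms by (simp add: y_def)
    have "1 / y\<^sup>2 - 2 / y ^ 3 \<le> 1 / (y + 1)\<^sup>2"
    proof -
      have "(y - 2) * (y + 1)\<^sup>2 \<le> y ^ 3"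
        using \<open>y \<ge> 1\<close> by (simp add: power2_eq_square power3_eq_cube algebra_simps)
      then have "(y - 2) / y ^ 3 \<le> 1 / (y + 1)\<^sup>2"
        using \<open>y \<ge> 1\<close> by (simp add: field_simps)
      moreover have "(y - 2) / y ^ 3 = 1 / y\<^sup>2 - 2 / y ^ 3"
        using \<open>y \<ge> 1\<close> by (simp add: diff_divide_distrib power2_eq_square power3_eq_cube)
      ultimately show ?thesis by simp
    qed
    moreover have "tail_mult N (r - 1) = 1 / y\<^sup>2 + 2 / y ^ 3"
      using 2 assms \<open>y \<ge> 1\<close> by (simp add: tail_mult_def y_def[symmetric] of_nat_diff field_simps
          power2_eq_square power3_eq_cube)
    moreover have "tail_mult N r = 1 / y\<^sup>2" "tail_mult N (Suc r) = 1 / (y + 1)\<^sup>2"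
      using 2 assms by (simp_all add: tail_mult_ge y_def add_ac)
    ultimately show ?thesis by simp
  next
    case 3
    define y where "y = real r"
    have y: "y \<ge> 2" using assms 3 by (simp add: y_def)
    have "2 / y\<^sup>2 \<le> 1 / (y - 1)\<^sup>2 + 1 / (y + 1)\<^sup>2"
    proof -
      have "1 / (y - 1)\<^sup>2 + 1 / (y + 1)\<^sup>2 = (2 * y\<^sup>2 + 2) / (y\<^sup>2 - 1)\<^sup>2"
      proof -
        have "(y - 1)\<^sup>2 * (y + 1)\<^sup>2 = (y\<^sup>2 - 1)\<^sup>2"
          by (simp add: power2_eq_square algebra_simps)
        moreover have "(y + 1)\<^sup>2 + (y - 1)\<^sup>2 = 2 * y\<^sup>2 + 2"
          by (simp add: power2_eq_square algebra_simps)
        moreover have "(y - 1)\<^sup>2 \<noteq> 0" "(y + 1)\<^sup>2 \<noteq> 0" using y by auto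
        ultimately show ?thesis
          by (metis add_frac_eq mult_1)
      qed
      moreover have "2 / y\<^sup>2 \<le> (2 * y\<^sup>2 + 2) / (y\<^sup>2 - 1)\<^sup>2"
      proof -
        define z where "z = y\<^sup>2"
        have z: "z > 1" using y by (simp add: z_def one_less_power)
        have "2 * (z - 1)\<^sup>2 \<le> (2 * z + 2) * z"
          using z by (simp add: power2_eq_square algebra_simps)
        then show ?thesis
          unfolding z_def[symmetric] using z by (simp add: divide_simps mult_ac)
      qed
      ultimately show ?thesis by simp
    qed
    moreover have "real (r - 1) = y - 1"
      using assms by (simp add: y_def of_nat_diff)
    then have "tail_mult N (r - 1) = 1 / (y - 1)\<^sup>2" "tail_mult N r = 1 / y\<^sup>2"
        "tail_mult N (Suc r) = 1 / (y + 1)\<^sup>2"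
      using 3 assms by (simp_all add: tail_mult_ge y_def add_ac)
    ultimately show ?thesis by simp
  qed
qed

lemma tail_mult_bound:
  assumes "N \<ge> 1" "N \<le> M" and B: "\<And>x. norm (trig_poly M c x) \<le> B"
  shows "norm (trig_poly M (\<lambda>j. of_real (tail_mult N (nat \<bar>j\<bar>)) * c j) x) \<le> 3 / (real N)\<^sup>2 * B"
proof -
  have "norm (trig_poly M (\<lambda>j. of_real (tail_mult N (nat \<bar>j\<bar>)) * c j) x) \<le> tail_mult N 0 * B"
  proof (rule convex_multiplier_bound[OF _ _ _ B])
    \<comment> \<open>As $N <= M$, both end values are inverse squares.\<close>
    show "tail_mult N (Suc M) \<ge> 0" "tail_mult N (Suc M) \<le> tail_mult N M"
      using assms(1,2) by (simp_all add: tail_mult_ge frac_le power_mono)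
  qed (use assms(1) tail_mult_convex in auto)
  then show ?thesis by (simp add: tail_mult_def)
qed

text \<open>The operator $I - U$ is applied to $p$ itself, but $RV$ to $p - \sigma$:
  this avoids the modulus of smoothness of $p - \sigma$.\<close>

lemma best_approx_trig_poly_step:
  fixes M n k :: nat and d :: "int \<Rightarrow> complex"
  assumes "h > 0" "n < M" and \<sigma>: "\<sigma> \<in> trig_polys n"
  defines "p \<equiv> trig_poly M d"
  shows "best_approx n p \<le> modulus_smoothness (2 * k) p h / real ((2 * k) choose k)
    + 3 / (real (Suc n))\<^sup>2 * (4 / h\<^sup>2 * (pi\<^sup>2 / 6 + 1)) * normT (\<lambda>x. p x - \<sigma> x)"
proof -
  obtain s0 where s0: "\<sigma> = trig_poly n s0"
    using \<sigma> by (auto simp: trig_polys_eq)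
  define s where "s j = (if \<bar>j\<bar> \<le> int n then s0 j else 0)" for j
  have s: "\<sigma> = trig_poly M s"
    using trig_poly_pad[of n M s0] \<open>n < M\<close> by (simp add: s0 s_def [abs_def])
  define c where "c j = d j - s j" for j
  define u v e where "u j = complex_of_real (smooth_mult k h j)"
    and "v j = complex_of_real (diff_mult k h j)"
    and "e j = complex_of_real (tail_mult (Suc n) (nat \<bar>j\<bar>))" for j
  \<comment> \<open>The witness is $U\<sigma> + (U - RV)(p - \<sigma>)$. Its first summand has
    degree at most $n$ like $\<sigma>$, and the second does because $U = RV$ at frequencies above
    $n$; \<open>Suc n\<close> is the first of these. Then $p - \<tau> = (p - Up) + RV(p -
    \<sigma>)$.\<close>
  define \<tau> where "\<tau> = trig_poly M (\<lambda>j. u j * s j + (u j - e j * v j) * c j)"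
  have "\<tau> \<in> trig_polys n"
    unfolding \<tau>_def
  proof (rule trig_poly_truncate)
    fix j assume j: "\<bar>j\<bar> > int n"
    then have "tail_mult (Suc n) (nat \<bar>j\<bar>) = 1 / (of_int j)\<^sup>2"
      by (subst tail_mult_ge) auto
    then have "u j = e j * v j"
      using j by (simp add: u_def v_def e_def smooth_mult_eq_diff_mult)
    then show "u j * s j + (u j - e j * v j) * c j = 0"
      using j by (simp add: s_def)
  qed (use \<open>n < M\<close> in simp)
  have "p \<in> CT" "\<sigma> \<in> CT"
    by (simp_all add: p_def s trig_poly_in_CT)
  have gc: "trig_poly M c x = p x - \<sigma> x" for x
    by (simp add: p_def s trig_poly_diff c_def [abs_def])
  have g: "norm (trig_poly M c x) \<le> normT (\<lambda>x. p x - \<sigma> x)" for x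
    unfolding gc using norm_le_normT[OF CT_diff[OF \<open>p \<in> CT\<close> \<open>\<sigma> \<in> CT\<close>]] .
  have "norm (p x - \<tau> x) \<le> modulus_smoothness (2 * k) p h / real ((2 * k) choose k)
      + 3 / (real (Suc n))\<^sup>2 * (4 / h\<^sup>2 * (pi\<^sup>2 / 6 + 1)) * normT (\<lambda>x. p x - \<sigma> x)"
    if "x \<in> circle" for x
  proof -
    have "p x - \<tau> x = (p x - trig_poly M (\<lambda>j. u j * d j) x)
        + trig_poly M (\<lambda>j. e j * (v j * c j)) x"
      unfolding p_def \<tau>_def trig_poly_diff trig_poly_add c_def by (simp add: algebra_simps)
    moreover have "norm (p x - trig_poly M (\<lambda>j. u j * d j) x)
        \<le> modulus_smoothness (2 * k) p h / real ((2 * k) choose k)"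
      unfolding p_def u_def by (rule averaged_difference_bound) (use assms(1) that in auto)
    moreover have "norm (trig_poly M (\<lambda>j. e j * (v j * c j)) x)
        \<le> 3 / (real (Suc n))\<^sup>2 * (4 / h\<^sup>2 * (pi\<^sup>2 / 6 + 1) * normT (\<lambda>x. p x - \<sigma> x))"
      unfolding e_def v_def
      by (intro tail_mult_bound diff_mult_bound g) (use assms in auto)
    ultimately show ?thesis
      unfolding mult.assoc by (simp only: norm_triangle_mono)
  qed
  then show ?thesis
    by (intro order_trans[OF best_approx_le[OF \<open>p \<in> CT\<close> \<open>\<tau> \<in> trig_polys n\<close>] normT_le])
qed

section \<open>The contraction factor, and passage to continuous functions\<close>

lemma contraction_factor_bound:
  fixes k n :: nat
  assumes "k \<ge> 1" "n \<ge> 1"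
  defines "h \<equiv> 2 * pi / real n * alpha * (1 + 1 / real k)"
  shows "3 / (real (Suc n))\<^sup>2 * (4 / h\<^sup>2 * (pi\<^sup>2 / 6 + 1)) \<le> (real k / (real k + 1))\<^sup>2"
proof -
  have "(2 powr (-5/2)) ^ 2 = (1/32 :: real)"
    by (subst powr_power) (simp_all add: powr_minus)
  moreover have "(3 powr (1/2)) ^ 2 = (3 :: real)"
    by (simp add: powr_power)
  ultimately have alpha: "alpha\<^sup>2 = 3 / 32 * pi\<^sup>2"
    unfolding alpha_def power_mult_distrib by simp
  define K where "K = (real k / (real k + 1))\<^sup>2"
  have "K > 0" using assms by (simp add: K_def)
  have "1 + 1 / real k = (real k + 1) / real k"
    using assms by (simp add: field_simps)
  then have "(1 + 1 / real k)\<^sup>2 = 1 / K"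
    by (simp add: K_def power_divide)
  \<comment> \<open>The constant \<open>alpha\<close> and the factor \<open>1 + 1 / real k\<close>
    enter only here: the latter supplies exactly $1/K$, so what remains is an inequality in
    \<open>pi\<close> alone.\<close>
  then have nh: "(real n)\<^sup>2 * h\<^sup>2 = 3 / 8 * (pi\<^sup>2 * pi\<^sup>2) / K"
    using assms(2) by (simp add: h_def power_mult_distrib power_divide alpha)
  have "h > 0"
    using assms(1,2) by (simp add: h_def alpha_def add_pos_nonneg)
  have "3 / (real (Suc n))\<^sup>2 * (4 / h\<^sup>2 * (pi\<^sup>2 / 6 + 1))
      = 12 * (pi\<^sup>2 / 6 + 1) / ((real (Suc n))\<^sup>2 * h\<^sup>2)"
    by (simp add: field_simps)
  also have "\<dots> \<le> 12 * (pi\<^sup>2 / 6 + 1) / ((real n)\<^sup>2 * h\<^sup>2)"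
    using \<open>h > 0\<close> assms(2) by (intro divide_left_mono mult_right_mono power_mono mult_pos_pos) auto
  also have "\<dots> = 32 * (pi\<^sup>2 / 6 + 1) / (pi\<^sup>2 * pi\<^sup>2) * K"
    unfolding nh using \<open>K > 0\<close> by (simp add: field_simps)
  also have "\<dots> \<le> 1 * K"
  proof (rule mult_right_mono)
    \<comment> \<open>With $x$ for \<open>pi\<^sup>2\<close>, the claim $32 (x/6 + 1) <= x^2$
      reduces to $32 <= (11/3) x$, and $x >= 9$ gives 33 on the right.\<close>
    have "9 * pi\<^sup>2 \<le> pi\<^sup>2 * pi\<^sup>2"
      using pi_squared_ge_9 by (intro mult_right_mono) auto
    then have "32 * (pi\<^sup>2 / 6 + 1) \<le> pi\<^sup>2 * pi\<^sup>2"
      using pi_squared_ge_9 by simp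
    then show "32 * (pi\<^sup>2 / 6 + 1) / (pi\<^sup>2 * pi\<^sup>2) \<le> 1"
      by simp
  qed (use \<open>K > 0\<close> in simp)
  finally show ?thesis by (simp add: K_def)
qed

text \<open>Taking the infimum over $\<sigma>$ in the preceding step gives $E <= B + qE$. Since $E$
  is finite and $q < 1$, it can be absorbed on the left.\<close>

lemma best_approx_trig_poly:
  fixes k n M :: nat and d :: "int \<Rightarrow> complex"
  assumes "k \<ge> 1" "n \<ge> 1"
  defines "h \<equiv> 2 * pi / real n * alpha * (1 + 1 / real k)" and "p \<equiv> trig_poly M d"
  shows "best_approx n p
    \<le> 2 * (real k + 1)\<^sup>2 / real ((2 * k) choose k) * modulus_smoothness (2 * k) p h"
proof -
  define B where "B = modulus_smoothness (2 * k) p h / real ((2 * k) choose k)"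
  define q where "q = 3 / (real (Suc n))\<^sup>2 * (4 / h\<^sup>2 * (pi\<^sup>2 / 6 + 1))"
  define E where "E = best_approx n p"
  have "h > 0"
    using assms(1,2) by (simp add: h_def alpha_def add_pos_nonneg)
  have "0 < pi\<^sup>2 / 6 + 1"
    by (intro add_nonneg_pos) auto
  then have "q > 0"
    unfolding q_def using \<open>h > 0\<close> by (intro mult_pos_pos divide_pos_pos) auto
  have "E \<ge> 0"
    unfolding E_def by (rule best_approx_nonneg) (simp add: p_def trig_poly_in_CT)
  \<comment> \<open>Padding with zero coefficients gives \<open>p\<close> a formal degree above $n$,
    as the step lemma requires.\<close>
  define M' where "M' = max M (Suc n)"
  obtain d' where d': "p = trig_poly M' d'"
    using trig_poly_pad[of M M' d] by (auto simp: p_def M'_def)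
  have "E \<le> B + q * normT (\<lambda>x. p x - \<sigma> x)" if "\<sigma> \<in> trig_polys n" for \<sigma>
    unfolding E_def B_def q_def d'
    by (rule best_approx_trig_poly_step) (use \<open>h > 0\<close> that in \<open>auto simp: M'_def\<close>)
  \<comment> \<open>Solving for the norm turns the estimate into a lower bound valid for every
    $\<sigma>$, so the infimum is reached without a minimiser.\<close>
  then have "(E - B) / q \<le> normT (\<lambda>x. p x - \<sigma> x)" if "\<sigma> \<in> trig_polys n" for \<sigma>
    using that \<open>q > 0\<close> by (simp add: divide_le_eq mult.commute diff_le_eq add.commute)
  then have "(E - B) / q \<le> E"
    unfolding E_def by (rule best_approx_greatest)
  then have "(1 - q) * E \<le> B"
    using \<open>q > 0\<close> by (simp add: divide_le_eq algebra_simps)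
  moreover have "1 / (2 * (real k + 1)\<^sup>2) \<le> 1 - q"
  proof -
    have "q \<le> (real k / (real k + 1))\<^sup>2"
      using contraction_factor_bound[OF assms(1,2)] by (simp only: q_def h_def)
    \<comment> \<open>The right side equals $(2k + 1)/(k + 1)^2$.\<close>
    moreover have "1 / (2 * (real k + 1)\<^sup>2) \<le> 1 - (real k / (real k + 1))\<^sup>2"
      by (simp add: power_divide divide_simps) (simp add: power2_eq_square algebra_simps)
    ultimately show ?thesis by linarith
  qed
  ultimately have "1 / (2 * (real k + 1)\<^sup>2) * E \<le> B"
    using \<open>E \<ge> 0\<close> mult_right_mono order_trans by blast
  then have "E \<le> B * (2 * (real k + 1)\<^sup>2)"
    by (simp add: divide_le_eq del: distrib_left_numeral)
  then show ?thesis by (simp add: E_def B_def mult_ac)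
qed

theorem theorem1:
  fixes k n :: nat and f :: "real \<Rightarrow> complex"
  assumes "k \<ge> 1" and "f \<in> CT" and "n \<ge> 2 * k"
  shows "best_approx n f
    \<le> 2 * (real k + 1)\<^sup>2 / real ((2 * k) choose k)
       * modulus_smoothness (2 * k) f (2 * pi / real n * alpha * (1 + 1 / real k))"
proof -
  define h where "h = 2 * pi / real n * alpha * (1 + 1 / real k)"
  define K where "K = 2 * (real k + 1)\<^sup>2 / real ((2 * k) choose k)"
  have n: "n \<ge> 1" using assms by simp
  have "h > 0"
    using assms(1) n by (simp add: h_def alpha_def add_pos_nonneg)
  have "K \<ge> 0" by (simp add: K_def)
  \<comment> \<open>An approximation of \<open>f\<close> within $e/L$ costs $e/L$ in the best
    approximation and at most $2^{2k} e/L$ in the modulus, the latter multiplied by $K$; together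
    this is $e$.\<close>
  define L where "L = 1 + K * 2 ^ (2 * k)"
  have "L > 0" using \<open>K \<ge> 0\<close> by (simp add: L_def add_pos_nonneg)
  have "best_approx n f \<le> K * modulus_smoothness (2 * k) f h + e" if "e > 0" for e
  proof -
    have "e / L > 0" using \<open>e > 0\<close> \<open>L > 0\<close> by simp
    then obtain M d where close: "\<And>x. norm (f x - trig_poly M d x) \<le> e / L"
      using trig_poly_dense[OF \<open>f \<in> CT\<close>] by blast
    define p where "p = trig_poly M d"
    have "best_approx n f \<le> best_approx n p + e / L"
      using \<open>f \<in> CT\<close> close by (intro best_approx_perturb) (simp_all add: p_def trig_poly_in_CT)
    also have "best_approx n p \<le> K * modulus_smoothness (2 * k) p h"
      unfolding K_def p_def h_def using assms(1) n by (rule best_approx_trig_poly)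
    also have "modulus_smoothness (2 * k) p h
        \<le> modulus_smoothness (2 * k) f h + 2 ^ (2 * k) * (e / L)"
      using \<open>f \<in> CT\<close> \<open>h > 0\<close> close
      by (intro modulus_smoothness_perturb) (simp_all add: p_def norm_minus_commute)
    finally have "best_approx n f
        \<le> K * (modulus_smoothness (2 * k) f h + 2 ^ (2 * k) * (e / L)) + e / L"
      using \<open>K \<ge> 0\<close> by (simp add: mult_left_mono)
    also have "\<dots> = K * modulus_smoothness (2 * k) f h + L * (e / L)"
      by (simp only: L_def ring_distribs mult_1 mult.assoc add_ac)
    finally show ?thesis using \<open>L > 0\<close> by simp
  qed
  then have "best_approx n f \<le> K * modulus_smoothness (2 * k) f h"
    by (rule field_le_epsilon)
  then show ?thesis by (simp only: K_def h_def)
qed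

end
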